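(* Let $G$ be a simple undirected graph without loops on the vertex set $\{1,\dots,n\}$, with positive edge weights, let $L=L(G)$ be its (weighted) Laplacian matrix and $\vec{d}=(d_1,\dots,d_n)^\top$ its vertex degree sequence. Suppose $D$ is a real symmetric $n\times n$ matrix with zero diagonal such that $D\ge W(G^{-1})$ entrywise, and that $$\left[LD+2I-(2\cdot\vec{1}-\vec{d})\vec{1}^\top\right]^\urcorner=0,$$ i.e. the $(i,j)$-entries of $LD+2I-(2\cdot\vec{1}-\vec{d})\vec{1}^\top$ vanish for all $i<j$. Then $G$ is a tree and $D=D(G^{-1})$ is the distance matrix of $G^{-1}$.
   Context: $I$ is the identity matrix and $\vec{1}$ the all-ones column vector of dimension $n$. For a square matrix $A=(a_{ij})$, $A^\urcorner$ is its strict upper triangular part: $a^\urcorner_{ij}=a_{ij}$ if $i<j$ and $0$ otherwise. For a graph $G$ with positive edge weights $w_{ij}>0$ ($ij\in E(G)$), the weight matrix $W(G)$ is the symmetric matrix with $w_{ij}(G)=w_{ij}$ if $ij\in E(G)$ and $0$ otherwise; the adjacency matrix $X(G)$ is the symmetric 0/1 matrix with $x_{ij}(G)=1$ iff $ij\in E(G)$. The degree sequence is $\vec{d}(G)=X(G)\vec{1}$ (unweighted degrees). The Laplacian is $L(G)=\operatorname{diag}(W(G)\vec{1})-W(G)$. $G^{-1}$ is $G$ with every edge weight replaced by its reciprocal, so $W(G^{-1})$ has entries $1/w_{ij}(G)$ for $ij\in E(G)$ and $0$ otherwise. The distance between vertices is the minimum total weight of a connecting path; the distance matrix $D(G^{-1})$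 has zero diagonal and these distances (computed in $G^{-1}$) off the diagonal. A tree is a connected graph with $n$ vertices and $n-1$ edges. *)

theory Defs
  imports "HOL-Analysis.Analysis"
begin

(* The index type 'v plays the role of {1..n}, with n = CARD('v); every element of 'v is a
   vertex.  The values of "weight" outside "edges" are irrelevant and never inspected. *)
record 'v wgraph =
  edges :: "'v set set"
  weight :: "'v set \<Rightarrow> real"

(* Edges are two-element sets, so there are no loops, multiple edges or directions. *)
definition weighted_graph :: "'v wgraph \<Rightarrow> bool" where
  "weighted_graph G \<longleftrightarrow> (\<forall>e\<in>edges G. card e = 2 \<and> weight G e > 0)"

definition weight_matrix :: "'v::finite wgraph \<Rightarrow> real^'v^'v" where
  "weight_matrix G = (\<chi> i j. if {i, j} \<in> edges G then weight G {i, j} else 0)"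

definition adjacency_matrix :: "'v::finite wgraph \<Rightarrow> real^'v^'v" where
  "adjacency_matrix G = (\<chi> i j. if {i, j} \<in> edges G then 1 else 0)"

definition ones :: "real^'v::finite" where
  "ones = (\<chi> i. 1)"

definition diag :: "real^'v \<Rightarrow> real^'v^'v::finite" where
  "diag x = (\<chi> i j. if i = j then x $ i else 0)"

(* The matrix product of the column x with the row y (transposed). *)
definition outer_product :: "real^'v \<Rightarrow> real^'v \<Rightarrow> real^'v^'v::finite" where
  "outer_product x y = (\<chi> i j. x $ i * y $ j)"

definition degree_sequence :: "'v::finite wgraph \<Rightarrow> real^'v" where
  "degree_sequence G = adjacency_matrix G *v ones"

definition laplacian :: "'v::finite wgraph \<Rightarrow> real^'v^'v" where
  "laplacian G = diag (weight_matrix G *v ones) - weight_matrix G"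

definition reciprocal_graph :: "'v wgraph \<Rightarrow> 'v wgraph" where
  "reciprocal_graph G = G\<lparr>weight := \<lambda>e. 1 / weight G e\<rparr>"

definition strict_upper ::
  "real^'v::{finite,linorder}^'v::{finite,linorder} \<Rightarrow> real^'v::{finite,linorder}^'v::{finite,linorder}" where
  "strict_upper A = (\<chi> i j. if i < j then A $ i $ j else 0)"

definition is_path :: "'v wgraph \<Rightarrow> 'v \<Rightarrow> 'v list \<Rightarrow> 'v \<Rightarrow> bool" where
  "is_path G u p v \<longleftrightarrow> p \<noteq> [] \<and> hd p = u \<and> last p = v \<and> distinct p \<and>
     successively (\<lambda>x y. {x, y} \<in> edges G) p"

definition path_weight :: "'v wgraph \<Rightarrow> 'v list \<Rightarrow> real" where
  "path_weight G p = (\<Sum>i<length p - 1. weight G {p ! i, p ! Suc i})"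

(* Paths do not repeat vertices, so there are finitely many of them and Min is a true minimum
   whenever u and v are connected; otherwise the value is unspecified. *)
definition distance :: "'v::finite wgraph \<Rightarrow> 'v \<Rightarrow> 'v \<Rightarrow> real" where
  "distance G u v = Min {path_weight G p | p. is_path G u p v}"

definition distance_matrix :: "'v::finite wgraph \<Rightarrow> real^'v^'v" where
  "distance_matrix G = (\<chi> i j. if i = j then 0 else distance G i j)"

definition connected_graph :: "'v wgraph \<Rightarrow> bool" where
  "connected_graph G \<longleftrightarrow> (\<forall>u v. \<exists>p. is_path G u p v)"

(* CARD('v) is at least 1, so the subtraction does not truncate. *)
definition is_tree :: "'v::finite wgraph \<Rightarrow> bool" where
  "is_tree G \<longleftrightarrow> connected_graph G \<and> card (edges G) = CARD('v) - 1"

end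

theory Submission
  imports Defs
begin

text \<open>
  Every column of the Laplacian times any matrix sums to zero over a union of components \<open>S\<close>.
  Applied to column \<open>Max S\<close>, where the hypothesis gives all entries but the diagonal one and
  \<open>D \<ge> W(G\<inverse>)\<close> bounds the latter, this yields \<open>\<Sum>i\<in>S. 2 - d\<^sub>i \<ge> 2\<close>; applied to
  column \<open>n \<notin> S\<close> it yields \<open>\<Sum>i\<in>S. 2 - d\<^sub>i = 0\<close>. Hence \<open>G\<close> is connected and has at most
  \<open>n - 1\<close> edges. In any connected graph the distance matrix \<open>T\<close> of \<open>G\<inverse>\<close> satisfies
  \<open>(L T)\<^sub>i\<^sub>j \<ge> 2 - d\<^sub>i\<close> for \<open>i \<noteq> j\<close> and \<open>(L T)\<^sub>j\<^sub>j \<ge> - d\<^sub>j\<close>; summing a column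
  gives at least \<open>n - 1\<close> edges, so \<open>G\<close> is a tree and all these inequalities are equalities.
  Thus \<open>T\<close> solves the same equations as \<open>D\<close>, and the columns of \<open>D - T\<close> vanish from the last
  to the first by the maximum principle.
\<close>

section \<open>The Laplacian as an operator, and degree sums\<close>

definition neighbours :: "'v wgraph \<Rightarrow> 'v \<Rightarrow> 'v set" where
  "neighbours G i = {k. {i, k} \<in> edges G}"

text \<open>These sets are the unions of connected components; column sums and the maximum principle
  can be phrased with them without mentioning paths.\<close>

definition adjacency_closed :: "'v wgraph \<Rightarrow> 'v set \<Rightarrow> bool" where
  "adjacency_closed G S \<longleftrightarrow> (\<forall>i\<in>S. neighbours G i \<subseteq> S)"

text \<open>Entry \<open>i\<close> of the Laplacian matrix times the vector \<open>f\<close>, in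
  difference form, so that signs and bounds can be read off neighbour by neighbour.\<close>

definition lap :: "'v wgraph \<Rightarrow> ('v \<Rightarrow> real) \<Rightarrow> 'v \<Rightarrow> real" where
  "lap G f i = (\<Sum>k\<in>neighbours G i. weight G {i, k} * (f i - f k))"

lemma neighbours_sym: "k \<in> neighbours G i \<longleftrightarrow> i \<in> neighbours G k"
  by (simp add: neighbours_def insert_commute)

lemma weight_pos: "weighted_graph G \<Longrightarrow> k \<in> neighbours G i \<Longrightarrow> weight G {i, k} > 0"
  by (auto simp: weighted_graph_def neighbours_def)

lemma adjacency_closed_Compl:
  "adjacency_closed G S \<Longrightarrow> adjacency_closed G (- S)"
  unfolding adjacency_closed_def by (metis ComplD ComplI neighbours_sym subset_iff)

lemma lap_diff: "lap G (\<lambda>k. f k - g k) i = lap G f i - lap G g i"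
  by (simp add: lap_def sum_subtractf[symmetric] algebra_simps)

lemma laplacian_mult_nth:
  fixes G :: "'v::finite wgraph"
  shows "(laplacian G ** D) $ i $ j = lap G (\<lambda>k. D $ k $ j) i"
proof -
  let ?W = "\<lambda>k. if {i, k} \<in> edges G then weight G {i, k} else 0"
  have "(laplacian G ** D) $ i $ j
      = (\<Sum>k\<in>UNIV. (if i = k then sum ?W UNIV * D $ k $ j else 0) - ?W k * D $ k $ j)"
    by (simp add: matrix_matrix_mult_def laplacian_def diag_def weight_matrix_def
        matrix_vector_mult_def ones_def left_diff_distrib if_distribR cong: if_cong)
       (intro sum.cong, auto)
  also have "\<dots> = sum ?W UNIV * D $ i $ j - (\<Sum>k\<in>UNIV. ?W k * D $ k $ j)"
    by (simp add: sum_subtractf)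
  also have "\<dots> = (\<Sum>k\<in>UNIV. if k \<in> neighbours G i
      then weight G {i, k} * (D $ i $ j - D $ k $ j) else 0)"
    unfolding sum_distrib_right sum_subtractf[symmetric]
    by (intro sum.cong) (auto simp: neighbours_def algebra_simps)
  also have "\<dots> = lap G (\<lambda>k. D $ k $ j) i"
    by (simp add: lap_def sum.If_cases)
  finally show ?thesis .
qed

lemma degree_sequence_nth:
  fixes G :: "'v::finite wgraph"
  shows "degree_sequence G $ i = real (card (neighbours G i))"
  by (simp add: degree_sequence_def matrix_vector_mult_def adjacency_matrix_def ones_def
      neighbours_def sum.If_cases)

text \<open>Closedness confines both indices of the double sum to \<open>S\<close>, and its summand
  changes sign when \<open>i\<close> and \<open>k\<close> are exchanged.\<close>

lemma sum_lap_eq_0: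
  fixes G :: "'v::finite wgraph"
  assumes "adjacency_closed G S"
  shows "(\<Sum>i\<in>S. lap G f i) = 0"
proof -
  let ?a = "\<lambda>i k. if k \<in> neighbours G i then weight G {i, k} * (f i - f k) else 0"
  have "lap G f i = (\<Sum>k\<in>S. ?a i k)" if "i \<in> S" for i
  proof -
    have "neighbours G i = S \<inter> neighbours G i"
      using assms that by (auto simp: adjacency_closed_def)
    then show ?thesis
      by (simp add: lap_def sum.If_cases)
  qed
  then have 1: "(\<Sum>i\<in>S. lap G f i) = (\<Sum>i\<in>S. \<Sum>k\<in>S. ?a i k)"
    by simp
  also have "\<dots> = (\<Sum>k\<in>S. \<Sum>i\<in>S. ?a i k)"
    by (rule sum.swap)
  also have "\<dots> = (\<Sum>k\<in>S. \<Sum>i\<in>S. - ?a k i)"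
    by (intro sum.cong) (auto simp: neighbours_sym[of _ G] insert_commute algebra_simps)
  also have "\<dots> = - (\<Sum>i\<in>S. lap G f i)"
    unfolding 1 by (simp only: sum_negf)
  finally show ?thesis
    by simp
qed

lemma handshake:
  fixes G :: "'v::finite wgraph"
  assumes "weighted_graph G"
  shows "(\<Sum>i\<in>UNIV. card (neighbours G i)) = 2 * card (edges G)"
proof -
  have "card (neighbours G i) = card {e \<in> edges G. i \<in> e}" for i
  proof (rule bij_betw_same_card[where f = "\<lambda>k. {i, k}"], unfold bij_betw_def, intro conjI)
    show "inj_on (\<lambda>k. {i, k}) (neighbours G i)"
      by (auto simp: inj_on_def doubleton_eq_iff)
    have "\<exists>k. e = {i, k}" if "e \<in> edges G" "i \<in> e" for e
    proof -
      have "card e = 2"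
        using assms that by (auto simp: weighted_graph_def)
      with \<open>i \<in> e\<close> show ?thesis
        by (auto simp: card_2_iff)
    qed
    then show "(\<lambda>k. {i, k}) ` neighbours G i = {e \<in> edges G. i \<in> e}"
      by (fastforce simp: neighbours_def)
  qed
  then have "(\<Sum>i\<in>UNIV. card (neighbours G i)) = (\<Sum>i\<in>UNIV. card {e \<in> edges G. i \<in> e})"
    by simp
  also have "\<dots> = (\<Sum>e\<in>edges G. card {i \<in> UNIV. i \<in> e})"
    by (rule sum_multicount_gen) auto
  also have "\<dots> = (\<Sum>e\<in>edges G. 2)"
    using assms by (intro sum.cong) (auto simp: weighted_graph_def)
  finally show ?thesis
    by simp
qed

text \<open>Translates degree sums into edge counts: the value 2 corresponds to exactly
  \<open>CARD('v) - 1\<close> edges.\<close>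

lemma sum_two_minus_degree:
  fixes G :: "'v::finite wgraph"
  assumes "weighted_graph G"
  shows "(\<Sum>i\<in>UNIV. 2 - real (card (neighbours G i))) = 2 * real CARD('v) - 2 * real (card (edges G))"
proof -
  have "(\<Sum>i\<in>UNIV. real (card (neighbours G i))) = 2 * real (card (edges G))"
    using arg_cong[OF handshake[OF assms], of real] by simp
  then show ?thesis
    by (simp add: sum_subtractf)
qed


section \<open>Paths and distances\<close>

lemma path_weight_Cons_Cons:
  "path_weight G (x # y # p) = weight G {x, y} + path_weight G (y # p)"
  by (simp add: path_weight_def sum.lessThan_Suc_shift del: sum.lessThan_Suc)

lemma path_weight_trivial [simp]: "path_weight G [] = 0" "path_weight G [x] = 0"
  by (simp_all add: path_weight_def)

lemma is_path_Cons:
  "is_path G i (i # p) j \<longleftrightarrow>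
    (if p = [] then i = j else i \<notin> set p \<and> hd p \<in> neighbours G i \<and> is_path G (hd p) p j)"
  by (cases p) (auto simp: is_path_def neighbours_def)

lemma is_path_ConsE:
  assumes "is_path G i p j"
  obtains p' where "p = i # p'"
  using assms by (cases p) (auto simp: is_path_def)

lemma is_path_refl: "is_path G i [i] i"
  by (simp add: is_path_def)

lemma is_path_same: "is_path G i p i \<longleftrightarrow> p = [i]"
  by (cases p) (auto simp: is_path_def split: if_splits)

text \<open>The witness is the part of \<open>p\<close> from \<open>i\<close> onwards; the edges cut
  off have positive weight.\<close>

lemma is_path_suffix:
  assumes "weighted_graph G" "is_path G k p j" "i \<in> set p"
  shows "\<exists>q. is_path G i q j \<and> path_weight G q \<le> path_weight G p"
  using assms(2,3)
proof (induction p arbitrary: k)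
  case Nil
  then show ?case
    by simp
next
  case (Cons x p)
  then have x: "x = k"
    by (simp add: is_path_def)
  show ?case
  proof (cases "i = k")
    case True
    then show ?thesis
      using Cons.prems by auto
  next
    case False
    with Cons.prems x have "i \<in> set p"
      by auto
    then obtain y p' where p: "p = y # p'"
      by (cases p) auto
    with Cons.prems x have "is_path G y p j" "y \<in> neighbours G x"
      by (auto simp: is_path_Cons)
    with Cons.IH \<open>i \<in> set p\<close> show ?thesis
      using weight_pos[OF assms(1) \<open>y \<in> neighbours G x\<close>] p
      by (fastforce simp: path_weight_Cons_Cons)
  qed
qed

text \<open>Paths have distinct vertices, so \<open>i\<close> can be prepended only if it is not on
  \<open>p\<close>; otherwise the suffix of \<open>p\<close> from \<open>i\<close> is already short
  enough.\<close>

lemma is_path_step: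
  assumes "weighted_graph G" "is_path G k p j" "k \<in> neighbours G i"
  shows "\<exists>q. is_path G i q j \<and> path_weight G q \<le> weight G {i, k} + path_weight G p"
proof (cases "i \<in> set p")
  case True
  then show ?thesis
    using is_path_suffix[OF assms(1,2)] weight_pos[OF assms(1,3)] by fastforce
next
  case False
  obtain p' where "p = k # p'"
    using assms(2) by (rule is_path_ConsE)
  then show ?thesis
    using False assms
    by (intro exI[of _ "i # p"]) (auto simp: is_path_Cons path_weight_Cons_Cons)
qed

lemma is_path_rev: "is_path G j (rev p) i \<longleftrightarrow> is_path G i p j"
  by (auto simp: is_path_def hd_rev last_rev insert_commute)

lemma path_weight_append:
  assumes "p \<noteq> []"
  shows "path_weight G (p @ [x]) = path_weight G p + weight G {last p, x}"
  using assms
proof (induction p)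
  case (Cons a p)
  then show ?case
    by (cases p) (auto simp: path_weight_Cons_Cons)
qed simp

lemma path_weight_rev: "path_weight G (rev p) = path_weight G p"
proof (induction p)
  case (Cons a p)
  then show ?case
    using path_weight_append[of "rev p" G a]
    by (cases p) (auto simp: path_weight_Cons_Cons insert_commute)
qed simp

lemma finite_path_weights:
  fixes G :: "'v::finite wgraph"
  shows "finite {path_weight G p | p. is_path G u p v}"
proof -
  have "finite {p :: 'v list. distinct p}"
    using finite_subset_distinct[of "UNIV :: 'v set"] by simp
  then have "finite {p. is_path G u p v}"
    by (rule rev_finite_subset) (auto simp: is_path_def)
  then show ?thesis
    by (simp add: Setcompr_eq_image)
qed

lemma distance_le:
  fixes G :: "'v::finite wgraph"
  assumes "is_path G u p v"
  shows "distance G u v \<le> path_weight G p"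
  unfolding distance_def by (intro Min_le finite_path_weights) (use assms in auto)

lemma distance_attained:
  fixes G :: "'v::finite wgraph"
  assumes "connected_graph G"
  obtains p where "is_path G u p v" "distance G u v = path_weight G p"
proof -
  have "{path_weight G p | p. is_path G u p v} \<noteq> {}"
    using assms by (auto simp: connected_graph_def)
  from Min_in[OF finite_path_weights this] show ?thesis
    using that by (auto simp: distance_def)
qed

lemma distance_sym: "distance G u v = distance G v u"
proof -
  have "{path_weight G p | p. is_path G u p v} = {path_weight G p | p. is_path G v p u}"
    by (auto; metis is_path_rev path_weight_rev)
  then show ?thesis
    by (simp add: distance_def)
qed

lemma distance_refl: "distance G u u = 0"
  by (simp add: distance_def is_path_same)

lemma distance_step_le:
  fixes G :: "'v::finite wgraph"
  assumes "weighted_graph G" "connected_graph G" "k \<in> neighbours G i"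
  shows "distance G i j \<le> weight G {i, k} + distance G k j"
proof -
  obtain p where p: "is_path G k p j" "distance G k j = path_weight G p"
    using assms(2) by (rule distance_attained)
  with is_path_step[OF assms(1) p(1) assms(3)] distance_le show ?thesis
    by force
qed

text \<open>The witness is the second vertex of a shortest path, which exists because
  \<open>i\<close> and \<open>j\<close> differ.\<close>

lemma distance_first_step:
  fixes G :: "'v::finite wgraph"
  assumes "connected_graph G" "i \<noteq> j"
  shows "\<exists>k\<in>neighbours G i. weight G {i, k} + distance G k j \<le> distance G i j"
proof -
  obtain p where p: "is_path G i p j" "distance G i j = path_weight G p"
    using assms(1) by (rule distance_attained)
  then obtain p' where p': "p = i # p'"
    by (auto elim: is_path_ConsE)
  with p assms(2) have "p' \<noteq> []"
    by (auto simp: is_path_Cons)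
  then obtain k q where q: "p' = k # q"
    by (cases p') auto
  with p p' have "k \<in> neighbours G i" "is_path G k p' j"
    by (auto simp: is_path_Cons)
  then show ?thesis
    using distance_le[of G k p' j] p(2) p' q by (intro bexI[of _ k]) (auto simp: path_weight_Cons_Cons)
qed

text \<open>The vertices with a path to \<open>v\<close> form a closed set, and so does their
  complement. Both cannot contain \<open>r\<close>, so the complement is empty.\<close>

lemma connected_graphI:
  assumes "weighted_graph G"
    and "\<And>S. adjacency_closed G S \<Longrightarrow> S \<noteq> {} \<Longrightarrow> r \<in> S"
  shows "connected_graph G"
proof -
  have "\<exists>p. is_path G u p v" for u v
  proof -
    define S where "S = {i. \<exists>p. is_path G i p v}"
    have "adjacency_closed G S"
      unfolding adjacency_closed_def S_def
      using is_path_step[OF assms(1)] neighbours_sym[of _ G] by blast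
    moreover have "v \<in> S"
      using is_path_refl[of G v] by (auto simp: S_def)
    ultimately have "- S = {}"
      using assms(2)[of S] assms(2)[of "- S"] adjacency_closed_Compl[of G S] by blast
    then show ?thesis
      by (auto simp: S_def)
  qed
  then show ?thesis
    by (simp add: connected_graph_def)
qed


section \<open>The Laplacian of the distance matrix of the reciprocal graph\<close>

lemma weighted_graph_reciprocal:
  "weighted_graph G \<Longrightarrow> weighted_graph (reciprocal_graph G)"
  by (simp add: weighted_graph_def reciprocal_graph_def)

lemma neighbours_reciprocal [simp]: "neighbours (reciprocal_graph G) i = neighbours G i"
  by (simp add: neighbours_def reciprocal_graph_def)

lemma connected_graph_reciprocal:
  "connected_graph G \<Longrightarrow> connected_graph (reciprocal_graph G)"
  by (simp add: connected_graph_def is_path_def reciprocal_graph_def)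

lemma weight_reciprocal [simp]: "weight (reciprocal_graph G) e = 1 / weight G e"
  by (simp add: reciprocal_graph_def)

text \<open>Distances from adjacent \<open>i\<close> and \<open>k\<close> to \<open>j\<close> differ
  by at most the reciprocal weight, so each neighbour contributes at least -1. If \<open>i\<close>
  differs from \<open>j\<close>, the next vertex on a shortest path contributes at least 1 instead,
  which raises the bound by 2.\<close>

lemma lap_distance_ge:
  fixes G :: "'v::finite wgraph"
  assumes "weighted_graph G" "connected_graph G"
  defines "T \<equiv> distance (reciprocal_graph G)"
  shows "lap G (\<lambda>k. T k j) i \<ge> (if i = j then 0 else 2) - real (card (neighbours G i))"
proof -
  let ?t = "\<lambda>k. weight G {i, k} * (T i j - T k j)"
  note R = weighted_graph_reciprocal[OF assms(1)] connected_graph_reciprocal[OF assms(2)]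
  have step: "?t k \<ge> - 1" if "k \<in> neighbours G i" for k
  proof -
    have w: "weight G {i, k} > 0"
      using assms(1) that by (rule weight_pos)
    have "T k j \<le> 1 / weight G {i, k} + T i j"
      using distance_step_le[OF R, of i k j] that
      by (simp add: T_def neighbours_sym[of i] insert_commute)
    with w show ?thesis
      by (simp add: field_simps)
  qed
  show ?thesis
  proof (cases "i = j")
    case True
    have "(\<Sum>k\<in>neighbours G i. - 1) \<le> lap G (\<lambda>k. T k j) i"
      unfolding lap_def by (intro sum_mono step)
    with True show ?thesis
      by simp
  next
    case False
    then obtain k0 where k0: "k0 \<in> neighbours G i" "1 / weight G {i, k0} + T k0 j \<le> T i j"
      using distance_first_step[OF R(2)] by (auto simp: T_def)
    have "weight G {i, k0} > 0"
      using assms(1) k0(1) by (rule weight_pos)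
    with k0(2) have "?t k0 \<ge> 1"
      by (simp add: field_simps)
    moreover have "(\<Sum>k\<in>neighbours G i - {k0}. - 1) \<le> (\<Sum>k\<in>neighbours G i - {k0}. ?t k)"
      by (intro sum_mono step) auto
    moreover have "lap G (\<lambda>k. T k j) i = ?t k0 + (\<Sum>k\<in>neighbours G i - {k0}. ?t k)"
      unfolding lap_def by (rule sum.remove) (use k0 in auto)
    moreover have "card (neighbours G i) = Suc (card (neighbours G i - {k0}))"
      using k0(1) by (simp only: card_Suc_Diff1 finite)
    ultimately show ?thesis
      using False by simp
  qed
qed

lemma sum_lap_lower_bound:
  fixes G :: "'v::finite wgraph"
  shows "(\<Sum>i\<in>UNIV. (if i = j then 0 else 2) - real (card (neighbours G i)))
    = (\<Sum>i\<in>UNIV. 2 - real (card (neighbours G i))) - 2"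
proof -
  have "(\<Sum>i\<in>UNIV. (if i = j then 0 else 2) - real (card (neighbours G i)))
    = (\<Sum>i\<in>UNIV. (2 - real (card (neighbours G i))) - (if i = j then 2 else 0))"
    by (intro sum.cong) auto
  then show ?thesis
    by (simp add: sum_subtractf)
qed

text \<open>The lower bounds on \<open>lap\<close> are summed over one arbitrary column, whose total
  is 0. This encodes that a connected graph has at least \<open>CARD('v) - 1\<close> edges.\<close>

lemma connected_graph_sum_two_minus_degree_le:
  fixes G :: "'v::finite wgraph"
  assumes "weighted_graph G" "connected_graph G"
  shows "(\<Sum>i\<in>UNIV. 2 - real (card (neighbours G i))) \<le> 2"
proof -
  fix j :: 'v
  have "(\<Sum>i\<in>UNIV. (if i = j then 0 else 2) - real (card (neighbours G i)))
      \<le> (\<Sum>i\<in>UNIV. lap G (\<lambda>k. distance (reciprocal_graph G) k j) i)"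
    by (intro sum_mono lap_distance_ge assms)
  then show ?thesis
    unfolding sum_lap_lower_bound by (simp add: sum_lap_eq_0 adjacency_closed_def)
qed

text \<open>The entrywise lower bounds now have the same total, 0, as the entries they bound, so
  each of them is attained.\<close>

lemma lap_distance_eq:
  fixes G :: "'v::finite wgraph"
  assumes "weighted_graph G" "connected_graph G" "i \<noteq> j"
    and "(\<Sum>i\<in>UNIV. 2 - real (card (neighbours G i))) = 2"
  shows "lap G (\<lambda>k. distance (reciprocal_graph G) k j) i = 2 - real (card (neighbours G i))"
proof -
  let ?l = "\<lambda>i. lap G (\<lambda>k. distance (reciprocal_graph G) k j) i"
  let ?b = "\<lambda>i. (if i = j then 0 else 2) - real (card (neighbours G i))"
  have "(\<Sum>i\<in>UNIV. ?b i) = (\<Sum>i\<in>UNIV. ?l i)"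
    unfolding sum_lap_lower_bound using assms(4)
    by (simp add: sum_lap_eq_0 adjacency_closed_def)
  then have "?b i = ?l i"
    by (rule sum_mono_inv[OF _ lap_distance_ge[OF assms(1,2)]]) auto
  with assms(3) show ?thesis
    by simp
qed


section \<open>The maximum principle\<close>

text \<open>A positive maximum would be attained on a closed set, by harmonicity on
  \<open>A\<close>. Such a set contains \<open>r\<close>, where \<open>f\<close> vanishes.\<close>

lemma harmonic_le_0:
  fixes G :: "'v::finite wgraph"
  assumes "weighted_graph G"
    and "\<And>S. adjacency_closed G S \<Longrightarrow> S \<noteq> {} \<Longrightarrow> r \<in> S"
    and "r \<notin> A" and "\<And>i. i \<notin> A \<Longrightarrow> f i = 0" and "\<And>i. i \<in> A \<Longrightarrow> lap G f i = 0"
  shows "f i \<le> 0"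
proof (rule ccontr)
  assume "\<not> f i \<le> 0"
  define M where "M = Max (range f)"
  define S where "S = {i. f i = M}"
  have le: "f k \<le> M" for k
    by (simp add: M_def)
  with \<open>\<not> f i \<le> 0\<close> have "M > 0"
    by (meson less_le_trans not_le)
  have "adjacency_closed G S"
    unfolding adjacency_closed_def
  proof (intro ballI subsetI)
    fix i k
    assume "i \<in> S" and k: "k \<in> neighbours G i"
    then have i: "f i = M"
      by (simp add: S_def)
    \<comment> \<open>Positivity of \<open>M\<close> keeps the maximum set inside \<open>A\<close>,
      where \<open>f\<close> is harmonic.\<close>
    with \<open>M > 0\<close> assms(4) have "i \<in> A"
      by force
    with assms(5) have "(\<Sum>k\<in>neighbours G i. weight G {i, k} * (f i - f k)) = 0"
      by (simp add: lap_def)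
    moreover have "weight G {i, k} * (f i - f k) \<ge> 0" if "k \<in> neighbours G i" for k
      using weight_pos[OF assms(1) that] le[of k] i by simp
    ultimately have "weight G {i, k} * (f i - f k) = 0"
      using k by (simp add: sum_nonneg_eq_0_iff)
    with weight_pos[OF assms(1) k] i show "k \<in> S"
      by (simp add: S_def)
  qed
  moreover have "M \<in> range f"
    unfolding M_def by (rule Max_in) auto
  then have "S \<noteq> {}"
    by (auto simp: S_def)
  ultimately have "f r = M"
    using assms(2)[of S] by (simp add: S_def)
  with \<open>M > 0\<close> assms(3,4) show False
    by force
qed

text \<open>The one-sided bound applies to \<open>f\<close> and to its negative, written
  \<open>0 - f k\<close> to fit \<open>lap_diff\<close>.\<close>

lemma harmonic_eq_0:
  fixes G :: "'v::finite wgraph"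
  assumes "weighted_graph G"
    and "\<And>S. adjacency_closed G S \<Longrightarrow> S \<noteq> {} \<Longrightarrow> r \<in> S"
    and "r \<notin> A" and "\<And>i. i \<notin> A \<Longrightarrow> f i = 0" and "\<And>i. i \<in> A \<Longrightarrow> lap G f i = 0"
  shows "f i = 0"
proof -
  have "lap G (\<lambda>k. 0 - f k) i = 0" if "i \<in> A" for i
    unfolding lap_diff using assms(5)[OF that] by (simp add: lap_def)
  then have "0 - f i \<le> 0"
    by (intro harmonic_le_0[OF assms(1,2,3), where f = "\<lambda>k. 0 - f k"]) (auto simp: assms(4))
  moreover have "f i \<le> 0"
    by (rule harmonic_le_0[OF assms])
  ultimately show ?thesis
    by simp
qed

section \<open>Column equations for \<open>D\<close> and their unique solution\<close>

text \<open>Here \<open>f\<close> stands for column \<open>Max S\<close> of \<open>D\<close>. Taking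
  the largest index puts all other rows in \<open>S\<close> above the diagonal, where the equations
  hold. The diagonal entry is at most minus the degree, and the entries over \<open>S\<close> sum to
  0; the missing 2 of the diagonal row is the bound.\<close>

lemma sum_two_minus_degree_ge:
  fixes G :: "'v::{finite,linorder} wgraph"
  assumes "weighted_graph G" "adjacency_closed G S" "S \<noteq> {}" "f (Max S) = 0"
    and "\<And>k. k \<in> neighbours G (Max S) \<Longrightarrow> 1 / weight G {Max S, k} \<le> f k"
    and "\<And>i. i < Max S \<Longrightarrow> lap G f i = 2 - real (card (neighbours G i))"
  shows "(\<Sum>i\<in>S. 2 - real (card (neighbours G i))) \<ge> 2"
proof -
  define j where "j = Max S"
  let ?d = "\<lambda>i. real (card (neighbours G i))"
  have j: "j \<in> S"
    using assms(3) by (simp add: j_def)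
  have "lap G f j \<le> (\<Sum>k\<in>neighbours G j. - 1)"
    unfolding lap_def
  proof (rule sum_mono)
    fix k
    assume k: "k \<in> neighbours G j"
    then have "1 \<le> weight G {j, k} * f k"
      using assms(5)[of k] weight_pos[OF assms(1) k] by (simp add: j_def field_simps)
    then show "weight G {j, k} * (f j - f k) \<le> - 1"
      using assms(4) by (simp add: j_def)
  qed
  moreover have "(\<Sum>i\<in>S - {j}. lap G f i) = (\<Sum>i\<in>S - {j}. 2 - ?d i)"
    using Max_ge[of S] by (intro sum.cong assms(6) refl) (auto simp: j_def order_less_le)
  moreover have "lap G f j + (\<Sum>i\<in>S - {j}. lap G f i) = 0"
    using sum_lap_eq_0[OF assms(2), of f] sum.remove[OF finite j, of "lap G f"] by simp
  moreover have "(\<Sum>i\<in>S. 2 - ?d i) = 2 - ?d j + (\<Sum>i\<in>S - {j}. 2 - ?d i)"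
    by (rule sum.remove[OF finite j])
  ultimately show ?thesis
    by simp
qed

theorem theorem2:
  fixes G :: "'v::{finite,linorder} wgraph"
    and D :: "real^'v::{finite,linorder}^'v::{finite,linorder}"
  assumes "weighted_graph G"
    and "transpose D = D"
    and "\<forall>i. D $ i $ i = 0"
    and "weight_matrix (reciprocal_graph G) \<le> D"
    and "strict_upper (laplacian G ** D + 2 *\<^sub>R mat 1
           - outer_product (2 *\<^sub>R ones - degree_sequence G) ones) = 0"
  shows "is_tree G \<and> D = distance_matrix (reciprocal_graph G)"
proof -
  let ?d = "\<lambda>i. real (card (neighbours G i))"
  let ?T = "distance (reciprocal_graph G)"
  define n :: 'v where "n = Max UNIV"
  have n: "i \<le> n" for i
    by (simp add: n_def)
  have D_sym: "D $ i $ j = D $ j $ i" for i j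
    using arg_cong[OF assms(2), of "\<lambda>A. A $ i $ j"] by (simp add: transpose_def)
  have D_ge: "1 / weight G {j, k} \<le> D $ k $ j" if "k \<in> neighbours G j" for j k
  proof -
    have "weight_matrix (reciprocal_graph G) $ k $ j \<le> D $ k $ j"
      using assms(4) by (simp add: less_eq_vec_def)
    with that show ?thesis
      by (simp add: weight_matrix_def neighbours_def insert_commute reciprocal_graph_def)
  qed
  have lap_D: "lap G (\<lambda>k. D $ k $ j) i = 2 - ?d i" if "i < j" for i j
  proof -
    have "strict_upper (laplacian G ** D + 2 *\<^sub>R mat 1
           - outer_product (2 *\<^sub>R ones - degree_sequence G) ones) $ i $ j = 0"
      by (simp add: assms(5))
    moreover have "i \<noteq> j"
      using that by simp
    ultimately show ?thesis
      using that by (simp add: strict_upper_def outer_product_def ones_def mat_def laplacian_mult_nth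
          degree_sequence_nth)
  qed
  have ge_2: "(\<Sum>i\<in>S. 2 - ?d i) \<ge> 2" if "adjacency_closed G S" "S \<noteq> {}" for S
    using assms(3) D_ge lap_D
    by (intro sum_two_minus_degree_ge[OF assms(1) that, of "\<lambda>k. D $ k $ Max S"]) auto
  \<comment> \<open>If \<open>n\<close> were outside \<open>S\<close>, the equations of column
    \<open>n\<close> would cover all rows in \<open>S\<close> and make the degree sum 0, against
    \<open>ge_2\<close>.\<close>
  have closed: "n \<in> S" if S: "adjacency_closed G S" "S \<noteq> {}" for S
  proof (rule ccontr)
    assume "n \<notin> S"
    then have "(\<Sum>i\<in>S. 2 - ?d i) = (\<Sum>i\<in>S. lap G (\<lambda>k. D $ k $ n) i)"
      using n by (intro sum.cong refl lap_D[symmetric]) (metis order_le_less)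
    with ge_2[OF S] sum_lap_eq_0[OF S(1)] show False
      by simp
  qed
  have conn: "connected_graph G"
    using assms(1) closed by (rule connected_graphI)
  have eq_2: "(\<Sum>i\<in>UNIV. 2 - ?d i) = 2"
    using ge_2[of UNIV] connected_graph_sum_two_minus_degree_le[OF assms(1) conn]
    by (simp add: adjacency_closed_def)
  then have "real (card (edges G)) + 1 = real CARD('v)"
    using sum_two_minus_degree[OF assms(1)] by simp
  then have tree: "is_tree G"
    using conn by (simp add: is_tree_def)
  \<comment> \<open>Columns are settled from the last to the first; the induction measure counts the
    columns after \<open>j\<close>.\<close>
  have "\<forall>i. D $ i $ j = ?T i j" for j
  proof (induction "card {j<..}" arbitrary: j rule: less_induct)
    case less
    \<comment> \<open>Entries below the diagonal are, by symmetry, entries of later columns.\<close>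
    have known: "D $ i $ j = ?T i j" if "j < i" for i
    proof -
      have "card {i<..} < card {j<..}"
        using that by (intro psubset_card_mono) auto
      with less have "D $ j $ i = ?T j i"
        by blast
      then show ?thesis
        by (metis D_sym distance_sym)
    qed
    have "D $ i $ j - ?T i j = 0" for i
    \<comment> \<open>Rows from \<open>j\<close> on are the zero boundary, which always includes
      \<open>n\<close>; in the rows before \<open>j\<close> both columns satisfy the same
      equation.\<close>
    proof (rule harmonic_eq_0[OF assms(1), where r = n and A = "{..<j}" and f = "\<lambda>i. D $ i $ j - ?T i j"])
      show "n \<in> S" if "adjacency_closed G S" "S \<noteq> {}" for S
        using that by (rule closed)
      show "n \<notin> {..<j}"
        using n[of j] by auto
      show "D $ i $ j - ?T i j = 0" if "i \<notin> {..<j}" for i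
        using that known[of i] assms(3) by (cases "i = j") (auto simp: distance_refl)
      show "lap G (\<lambda>i. D $ i $ j - ?T i j) i = 0" if "i \<in> {..<j}" for i
        using that lap_D[of i j] lap_distance_eq[OF assms(1) conn _ eq_2, of i j]
        by (simp add: lap_diff)
    qed
    then show ?case
      by simp
  qed
  then have "D = distance_matrix (reciprocal_graph G)"
    using assms(3) by (auto simp: vec_eq_iff distance_matrix_def)
  with tree show ?thesis
    by simp
qed

end
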